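(* A function $f\in\mathcal HL_0(\mathbb D)$ is an extreme point of the closed unit ball of $\mathcal HL_0(\mathbb D)$ if and only if its derivative $f'$ is an extreme point of the closed unit ball of $\mathcal H^\infty(\mathbb D)$.
   Context: $\mathbb D$ is the open unit disc in $\mathbb C$. $\mathcal HL_0(\mathbb D)$ is the Banach space of holomorphic Lipschitz functions $f:\mathbb D\to\mathbb C$ with $f(0)=0$, normed by the Lipschitz constant $L(f)$. $\mathcal H^\infty(\mathbb D)$ is the Banach space of bounded holomorphic functions on $\mathbb D$ with the supremum norm. *)

theory Defs
  imports "HOL-Complex_Analysis.Complex_Analysis"
begin

text \<open>
  Functions on the open unit disc are represented by total functions that vanish off the disc,
  so that two elements of the spaces below are equal iff they agree on the disc.  The complex spaces are
  regarded as real normed spaces, which suffices for extreme points: these involve real segments only.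
\<close>

abbreviation unit_disc :: "complex set" where
  "unit_disc \<equiv> ball 0 1"

definition sup_norm :: "(complex \<Rightarrow> complex) \<Rightarrow> real" where
  "sup_norm f = (SUP z\<in>unit_disc. norm (f z))"

definition lip_const :: "(complex \<Rightarrow> complex) \<Rightarrow> real" where
  "lip_const f =
     (SUP (z, w)\<in>{(z, w). z \<in> unit_disc \<and> w \<in> unit_disc \<and> z \<noteq> w}. norm (f z - f w) / norm (z - w))"

lemma sup_norm_upper:
  assumes "bounded (f ` unit_disc)" "z \<in> unit_disc"
  shows "norm (f z) \<le> sup_norm f"
  unfolding sup_norm_def
proof (rule cSUP_upper[OF assms(2)])
  show "bdd_above ((\<lambda>z. norm (f z)) ` unit_disc)"
    using assms(1) by (auto simp: bounded_iff bdd_above_def)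
qed

lemma sup_norm_least:
  assumes "\<And>z. z \<in> unit_disc \<Longrightarrow> norm (f z) \<le> B"
  shows "sup_norm f \<le> B"
  unfolding sup_norm_def by (rule cSUP_least) (use assms in auto)

lemma lip_const_upper:
  assumes "C-lipschitz_on unit_disc f" "z \<in> unit_disc" "w \<in> unit_disc"
  shows "norm (f z - f w) \<le> lip_const f * norm (z - w)"
proof (cases "z = w")
  case False
  let ?P = "{(z, w). z \<in> unit_disc \<and> w \<in> unit_disc \<and> z \<noteq> w}"
  have "bdd_above ((\<lambda>(z, w). norm (f z - f w) / norm (z - w)) ` ?P)"
    unfolding bdd_above_def
    using lipschitz_onD[OF assms(1)] by (intro exI[of _ C]) (auto simp: dist_norm divide_le_eq)
  then have "norm (f z - f w) / norm (z - w) \<le> lip_const f"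
    unfolding lip_const_def using cSUP_upper[of "(z, w)" ?P] assms False by fastforce
  then show ?thesis using False by (simp add: divide_le_eq)
qed simp

lemma lip_const_least:
  assumes "\<And>z w. z \<in> unit_disc \<Longrightarrow> w \<in> unit_disc \<Longrightarrow> norm (f z - f w) \<le> B * norm (z - w)"
  shows "lip_const f \<le> B"
  unfolding lip_const_def
proof (rule cSUP_least)
  have "(0, 1/2) \<in> {(z, w). z \<in> unit_disc \<and> w \<in> unit_disc \<and> z \<noteq> (w::complex)}"
    by simp
  then show "{(z, w). z \<in> unit_disc \<and> w \<in> unit_disc \<and> z \<noteq> (w::complex)} \<noteq> {}"
    by blast
qed (use assms in \<open>auto simp: divide_le_eq\<close>)

lemma lip_const_nonneg:
  assumes "C-lipschitz_on unit_disc f"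
  shows "0 \<le> lip_const f"
proof -
  have "0 \<le> norm (f 0 - f (1/2))" by simp
  also have "\<dots> \<le> lip_const f * norm (0 - 1/2 :: complex)"
    by (rule lip_const_upper[OF assms]) auto
  finally show ?thesis by (simp add: zero_le_mult_iff)
qed

lemma deriv_bound:
  assumes "C-lipschitz_on unit_disc f" "f holomorphic_on unit_disc" "z \<in> unit_disc"
  shows "norm (deriv f z) \<le> C"
proof -
  have "(f has_field_derivative deriv f z) (at z)"
    using assms(2,3) holomorphic_derivI open_ball by blast
  then have lim: "((\<lambda>w. (f w - f z) / (w - z)) \<longlongrightarrow> deriv f z) (at z)"
    by (simp add: has_field_derivative_iff)
  have ev: "\<forall>\<^sub>F w in at z. w \<in> unit_disc"
    using assms(3) by (intro eventually_at_in_open') auto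
  have "\<forall>\<^sub>F w in at z. norm ((f w - f z) / (w - z)) \<le> C"
    using ev eventually_neq_at_within[of z z UNIV]
  proof eventually_elim
    case (elim w)
    then show ?case
      using lipschitz_onD[OF assms(1) elim(1) assms(3)]
      by (simp add: dist_norm norm_divide divide_le_eq)
  qed
  then show ?thesis
    using tendsto_upperbound[OF tendsto_norm[OF lim]] by simp
qed

typedef hlip0 =
  "{f :: complex \<Rightarrow> complex. f holomorphic_on unit_disc \<and> (\<exists>C. C-lipschitz_on unit_disc f) \<and>
      f 0 = 0 \<and> (\<forall>z. z \<notin> unit_disc \<longrightarrow> f z = 0)}"
  by (rule exI[of _ "\<lambda>_. 0"]) (auto intro!: exI[of _ 0] lipschitz_onI)

setup_lifting type_definition_hlip0

typedef hinf =
  "{f :: complex \<Rightarrow> complex. f holomorphic_on unit_disc \<and> bounded (f ` unit_disc) \<and>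
      (\<forall>z. z \<notin> unit_disc \<longrightarrow> f z = 0)}"
  by (rule exI[of _ "\<lambda>_. 0"]) (auto simp: bounded_iff)

setup_lifting type_definition_hinf

instantiation hlip0 :: real_normed_vector
begin

lift_definition zero_hlip0 :: hlip0 is "\<lambda>_. 0"
  by (auto intro!: exI[of _ 0] lipschitz_onI)

lift_definition plus_hlip0 :: "hlip0 \<Rightarrow> hlip0 \<Rightarrow> hlip0" is "\<lambda>f g z. f z + g z"
  by (auto intro!: holomorphic_intros intro: lipschitz_on_add)

lift_definition minus_hlip0 :: "hlip0 \<Rightarrow> hlip0 \<Rightarrow> hlip0" is "\<lambda>f g z. f z - g z"
  by (auto intro!: holomorphic_intros intro: lipschitz_on_diff)

lift_definition uminus_hlip0 :: "hlip0 \<Rightarrow> hlip0" is "\<lambda>f z. - f z"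
  by (auto intro!: holomorphic_intros)

lift_definition scaleR_hlip0 :: "real \<Rightarrow> hlip0 \<Rightarrow> hlip0" is "\<lambda>r f z. r *\<^sub>R f z"
proof -
  fix r :: real and f :: "complex \<Rightarrow> complex"
  assume f: "f holomorphic_on unit_disc \<and> (\<exists>C. C-lipschitz_on unit_disc f) \<and>
      f 0 = 0 \<and> (\<forall>z. z \<notin> unit_disc \<longrightarrow> f z = 0)"
  have "(\<lambda>z. r *\<^sub>R f z) holomorphic_on unit_disc"
    unfolding scaleR_conv_of_real using f by (intro holomorphic_intros) auto
  moreover have "\<exists>C. C-lipschitz_on unit_disc (\<lambda>z. r *\<^sub>R f z)"
    using f lipschitz_on_cmult by blast
  ultimately show "(\<lambda>z. r *\<^sub>R f z) holomorphic_on unit_disc \<and>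
      (\<exists>C. C-lipschitz_on unit_disc (\<lambda>z. r *\<^sub>R f z)) \<and>
      r *\<^sub>R f 0 = 0 \<and> (\<forall>z. z \<notin> unit_disc \<longrightarrow> r *\<^sub>R f z = 0)"
    using f by simp
qed

lift_definition norm_hlip0 :: "hlip0 \<Rightarrow> real" is lip_const .

definition dist_hlip0 :: "hlip0 \<Rightarrow> hlip0 \<Rightarrow> real" where
  "dist_hlip0 f g = norm (f - g)"

definition sgn_hlip0 :: "hlip0 \<Rightarrow> hlip0" where
  "sgn_hlip0 f = inverse (norm f) *\<^sub>R f"

definition uniformity_hlip0 :: "(hlip0 \<times> hlip0) filter" where
  "uniformity_hlip0 = (INF e\<in>{0<..}. principal {(f, g). dist f g < e})"

definition open_hlip0 :: "hlip0 set \<Rightarrow> bool" where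
  "open_hlip0 U = (\<forall>f\<in>U. \<forall>\<^sub>F (f', g) in uniformity. f' = f \<longrightarrow> g \<in> U)"

instance
proof
  fix f g h :: hlip0 and a b :: real
  show "f + g + h = f + (g + h)" by transfer (simp add: add.assoc)
  show "f + g = g + f" by transfer (simp add: add.commute)
  show "0 + f = f" by transfer simp
  show "- f + f = 0" by transfer simp
  show "f - g = f + - g" by transfer simp
  show "a *\<^sub>R (f + g) = a *\<^sub>R f + a *\<^sub>R g" by transfer (simp add: scaleR_add_right)
  show "(a + b) *\<^sub>R f = a *\<^sub>R f + b *\<^sub>R f" by transfer (simp add: scaleR_add_left)
  show "a *\<^sub>R b *\<^sub>R f = (a * b) *\<^sub>R f" by transfer simp
  show "1 *\<^sub>R f = f" by transfer simp
  show "dist f g = norm (f - g)" by (rule dist_hlip0_def)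
  show "sgn f = inverse (norm f) *\<^sub>R f" by (rule sgn_hlip0_def)
  show "uniformity = (INF e\<in>{0<..}. principal {(f, g :: hlip0). dist f g < e})"
    by (rule uniformity_hlip0_def)
  show "open U = (\<forall>f\<in>U. \<forall>\<^sub>F (f', g) in uniformity. f' = f \<longrightarrow> g \<in> U)" for U :: "hlip0 set"
    by (rule open_hlip0_def)
  show "(norm f = 0) = (f = 0)"
  proof transfer
    fix f :: "complex \<Rightarrow> complex"
    assume f: "f holomorphic_on unit_disc \<and> (\<exists>C. C-lipschitz_on unit_disc f) \<and>
      f 0 = 0 \<and> (\<forall>z. z \<notin> unit_disc \<longrightarrow> f z = 0)"
    then obtain C where C: "C-lipschitz_on unit_disc f" by blast
    show "(lip_const f = 0) = (f = (\<lambda>_. 0))"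
    proof
      assume L: "lip_const f = 0"
      show "f = (\<lambda>_. 0)"
      proof
        fix z show "f z = 0"
          using lip_const_upper[OF C, of z 0] f L by (cases "z \<in> unit_disc") auto
      qed
    next
      assume "f = (\<lambda>_. 0)"
      then show "lip_const f = 0"
        using lip_const_nonneg[OF C] lip_const_least[of f 0] by simp
    qed
  qed
  show "norm (f + g) \<le> norm f + norm g"
  proof transfer
    fix f g :: "complex \<Rightarrow> complex"
    assume "f holomorphic_on unit_disc \<and> (\<exists>C. C-lipschitz_on unit_disc f) \<and>
      f 0 = 0 \<and> (\<forall>z. z \<notin> unit_disc \<longrightarrow> f z = 0)"
      and "g holomorphic_on unit_disc \<and> (\<exists>C. C-lipschitz_on unit_disc g) \<and>
      g 0 = 0 \<and> (\<forall>z. z \<notin> unit_disc \<longrightarrow> g z = 0)"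
    then obtain C D where C: "C-lipschitz_on unit_disc f" and D: "D-lipschitz_on unit_disc g"
      by blast
    show "lip_const (\<lambda>z. f z + g z) \<le> lip_const f + lip_const g"
    proof (rule lip_const_least)
      fix z w :: complex assume zw: "z \<in> unit_disc" "w \<in> unit_disc"
      have "norm (f z + g z - (f w + g w)) \<le> norm (f z - f w) + norm (g z - g w)"
        by (rule norm_diff_triangle_ineq)
      also have "\<dots> \<le> lip_const f * norm (z - w) + lip_const g * norm (z - w)"
        by (intro add_mono lip_const_upper[OF C] lip_const_upper[OF D] zw)
      finally show "norm (f z + g z - (f w + g w)) \<le> (lip_const f + lip_const g) * norm (z - w)"
        by (simp add: distrib_right)
    qed
  qed
  have le: "norm (a *\<^sub>R f) \<le> \<bar>a\<bar> * norm f" for a and f :: hlip0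
  proof transfer
    fix a and f :: "complex \<Rightarrow> complex"
    assume "f holomorphic_on unit_disc \<and> (\<exists>C. C-lipschitz_on unit_disc f) \<and>
      f 0 = 0 \<and> (\<forall>z. z \<notin> unit_disc \<longrightarrow> f z = 0)"
    then obtain C where C: "C-lipschitz_on unit_disc f" by blast
    show "lip_const (\<lambda>z. a *\<^sub>R f z) \<le> \<bar>a\<bar> * lip_const f"
    proof (rule lip_const_least)
      fix z w :: complex assume zw: "z \<in> unit_disc" "w \<in> unit_disc"
      have "norm (a *\<^sub>R f z - a *\<^sub>R f w) = \<bar>a\<bar> * norm (f z - f w)"
        by (simp flip: scaleR_diff_right)
      then show "norm (a *\<^sub>R f z - a *\<^sub>R f w) \<le> \<bar>a\<bar> * lip_const f * norm (z - w)"
        using mult_left_mono[OF lip_const_upper[OF C zw], of "\<bar>a\<bar>"] by (simp add: mult.assoc)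
    qed
  qed
  show "norm (a *\<^sub>R f) = \<bar>a\<bar> * norm f"
  proof (cases "a = 0")
    case True
    have "norm (0 :: hlip0) \<le> 0" by transfer (rule lip_const_least, simp)
    moreover have "0 \<le> norm (0 :: hlip0)"
      by transfer (rule lip_const_nonneg[of 0], auto intro: lipschitz_onI)
    moreover have "0 *\<^sub>R f = 0" by transfer simp
    ultimately show ?thesis using True by simp
  next
    case False
    have "inverse a *\<^sub>R a *\<^sub>R f = f" using False by transfer simp
    then have "norm f \<le> \<bar>inverse a\<bar> * norm (a *\<^sub>R f)" using le[of "inverse a" "a *\<^sub>R f"] by simp
    then have "\<bar>a\<bar> * norm f \<le> norm (a *\<^sub>R f)" using False by (simp add: field_simps)
    then show ?thesis using le[of a f] by simp
  qed
qed

end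

instantiation hinf :: real_normed_vector
begin

lift_definition zero_hinf :: hinf is "\<lambda>_. 0"
  by (auto simp: bounded_iff)

lift_definition plus_hinf :: "hinf \<Rightarrow> hinf \<Rightarrow> hinf" is "\<lambda>f g z. f z + g z"
  by (auto intro!: holomorphic_intros intro: bounded_plus_comp)

lift_definition minus_hinf :: "hinf \<Rightarrow> hinf \<Rightarrow> hinf" is "\<lambda>f g z. f z - g z"
  by (auto intro!: holomorphic_intros intro: bounded_minus_comp)

lift_definition uminus_hinf :: "hinf \<Rightarrow> hinf" is "\<lambda>f z. - f z"
  by (auto intro!: holomorphic_intros simp: bounded_iff)

lift_definition scaleR_hinf :: "real \<Rightarrow> hinf \<Rightarrow> hinf" is "\<lambda>r f z. r *\<^sub>R f z"
proof -
  fix r :: real and f :: "complex \<Rightarrow> complex"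
  assume f: "f holomorphic_on unit_disc \<and> bounded (f ` unit_disc) \<and>
      (\<forall>z. z \<notin> unit_disc \<longrightarrow> f z = 0)"
  have "(\<lambda>z. r *\<^sub>R f z) holomorphic_on unit_disc"
    unfolding scaleR_conv_of_real using f by (intro holomorphic_intros) auto
  moreover have "bounded ((\<lambda>z. r *\<^sub>R f z) ` unit_disc)"
    using f bounded_scaleR_comp by blast
  ultimately show "(\<lambda>z. r *\<^sub>R f z) holomorphic_on unit_disc \<and>
      bounded ((\<lambda>z. r *\<^sub>R f z) ` unit_disc) \<and> (\<forall>z. z \<notin> unit_disc \<longrightarrow> r *\<^sub>R f z = 0)"
    using f by simp
qed

lift_definition norm_hinf :: "hinf \<Rightarrow> real" is sup_norm .

definition dist_hinf :: "hinf \<Rightarrow> hinf \<Rightarrow> real" where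
  "dist_hinf f g = norm (f - g)"

definition sgn_hinf :: "hinf \<Rightarrow> hinf" where
  "sgn_hinf f = inverse (norm f) *\<^sub>R f"

definition uniformity_hinf :: "(hinf \<times> hinf) filter" where
  "uniformity_hinf = (INF e\<in>{0<..}. principal {(f, g). dist f g < e})"

definition open_hinf :: "hinf set \<Rightarrow> bool" where
  "open_hinf U = (\<forall>f\<in>U. \<forall>\<^sub>F (f', g) in uniformity. f' = f \<longrightarrow> g \<in> U)"

instance
proof
  fix f g h :: hinf and a b :: real
  show "f + g + h = f + (g + h)" by transfer (simp add: add.assoc)
  show "f + g = g + f" by transfer (simp add: add.commute)
  show "0 + f = f" by transfer simp
  show "- f + f = 0" by transfer simp
  show "f - g = f + - g" by transfer simp
  show "a *\<^sub>R (f + g) = a *\<^sub>R f + a *\<^sub>R g" by transfer (simp add: scaleR_add_right)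
  show "(a + b) *\<^sub>R f = a *\<^sub>R f + b *\<^sub>R f" by transfer (simp add: scaleR_add_left)
  show "a *\<^sub>R b *\<^sub>R f = (a * b) *\<^sub>R f" by transfer simp
  show "1 *\<^sub>R f = f" by transfer simp
  show "dist f g = norm (f - g)" by (rule dist_hinf_def)
  show "sgn f = inverse (norm f) *\<^sub>R f" by (rule sgn_hinf_def)
  show "uniformity = (INF e\<in>{0<..}. principal {(f, g :: hinf). dist f g < e})"
    by (rule uniformity_hinf_def)
  show "open U = (\<forall>f\<in>U. \<forall>\<^sub>F (f', g) in uniformity. f' = f \<longrightarrow> g \<in> U)" for U :: "hinf set"
    by (rule open_hinf_def)
  show "(norm f = 0) = (f = 0)"
  proof transfer
    fix f :: "complex \<Rightarrow> complex"
    assume f: "f holomorphic_on unit_disc \<and> bounded (f ` unit_disc) \<and>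
      (\<forall>z. z \<notin> unit_disc \<longrightarrow> f z = 0)"
    show "(sup_norm f = 0) = (f = (\<lambda>_. 0))"
    proof
      assume L: "sup_norm f = 0"
      show "f = (\<lambda>_. 0)"
      proof
        fix z show "f z = 0"
          using sup_norm_upper[of f z] f L by (cases "z \<in> unit_disc") auto
      qed
    qed (simp add: sup_norm_def)
  qed
  show "norm (f + g) \<le> norm f + norm g"
    by transfer (auto intro!: sup_norm_least intro: norm_triangle_mono sup_norm_upper simp del: mem_ball mem_ball_0)
  have le: "norm (a *\<^sub>R f) \<le> \<bar>a\<bar> * norm f" for a and f :: hinf
    by transfer (auto intro!: sup_norm_least mult_left_mono intro: sup_norm_upper simp del: mem_ball mem_ball_0)
  show "norm (a *\<^sub>R f) = \<bar>a\<bar> * norm f"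
  proof (cases "a = 0")
    case True
    have "norm (0 :: hinf) = 0" by transfer (simp add: sup_norm_def)
    moreover have "0 *\<^sub>R f = 0" by transfer simp
    ultimately show ?thesis using True by simp
  next
    case False
    have "inverse a *\<^sub>R a *\<^sub>R f = f" using False by transfer simp
    then have "norm f \<le> \<bar>inverse a\<bar> * norm (a *\<^sub>R f)" using le[of "inverse a" "a *\<^sub>R f"] by simp
    then have "\<bar>a\<bar> * norm f \<le> norm (a *\<^sub>R f)" using False by (simp add: field_simps)
    then show ?thesis using le[of a f] by simp
  qed
qed

end

lift_definition hlip0_deriv :: "hlip0 \<Rightarrow> hinf"
  is "\<lambda>f z. if z \<in> unit_disc then deriv f z else 0"
proof -
  fix f :: "complex \<Rightarrow> complex"
  assume f: "f holomorphic_on unit_disc \<and> (\<exists>C. C-lipschitz_on unit_disc f) \<and>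
      f 0 = 0 \<and> (\<forall>z. z \<notin> unit_disc \<longrightarrow> f z = 0)"
  have "deriv f holomorphic_on unit_disc"
    using f by (intro holomorphic_deriv) auto
  then have "(\<lambda>z. if z \<in> unit_disc then deriv f z else 0) holomorphic_on unit_disc"
    by (rule holomorphic_transform) simp
  moreover have "bounded ((\<lambda>z. if z \<in> unit_disc then deriv f z else 0) ` unit_disc)"
    using f deriv_bound unfolding bounded_iff by fastforce
  ultimately show "(\<lambda>z. if z \<in> unit_disc then deriv f z else 0) holomorphic_on unit_disc \<and>
      bounded ((\<lambda>z. if z \<in> unit_disc then deriv f z else 0) ` unit_disc) \<and>
      (\<forall>z. z \<notin> unit_disc \<longrightarrow> (if z \<in> unit_disc then deriv f z else 0) = 0)"
    by simp
qed

end

theory Submission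
  imports Defs
begin

text \<open>
  Differentiation is a surjective linear isometry from the Lipschitz functions vanishing at \<open>0\<close>
  onto the bounded holomorphic functions, so it carries the closed unit ball of the one space onto
  that of the other, and with it the extreme points.

  The isometry property is the mean value inequality together with the bound of a derivative by
  difference quotients (\<open>lip_const_eq_sup_norm_deriv\<close>).  Surjectivity holds because the disc is convex:
  a bounded holomorphic function has a primitive there, and boundedness of its derivative makes that
  primitive Lipschitz (\<open>surj_hlip0_deriv\<close>).
\<close>

text \<open>The mean value inequality along segments, which stay in the disc by convexity.\<close>

lemma lipschitz_on_disc_if_deriv_bounded:
  assumes "f holomorphic_on unit_disc" "\<And>z. z \<in> unit_disc \<Longrightarrow> norm (deriv f z) \<le> B"
  shows "B-lipschitz_on unit_disc f"
proof (rule lipschitz_onI)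
  show "0 \<le> B"
    using assms(2)[of 0] norm_ge_zero[of "deriv f 0"] by (simp del: norm_ge_zero)
next
  fix z w :: complex assume "z \<in> unit_disc" "w \<in> unit_disc"
  moreover have "(f has_field_derivative deriv f z) (at z within unit_disc)" if "z \<in> unit_disc" for z
    using assms(1) that by (meson holomorphic_derivI open_ball)
  ultimately show "dist (f z) (f w) \<le> B * dist z w"
    unfolding dist_norm using assms(2) by (intro field_differentiable_bound[of unit_disc]) auto
qed

text \<open>
  By the mean value inequality any bound of the derivative is a Lipschitz constant; conversely any
  Lipschitz constant bounds the difference quotients and hence their limits.
\<close>

lemma lip_const_eq_sup_norm_deriv:
  assumes hol: "f holomorphic_on unit_disc" and lip: "C-lipschitz_on unit_disc f"
  shows "lip_const f = sup_norm (deriv f)"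
proof (rule antisym)
  have "bounded (deriv f ` unit_disc)"
    unfolding bounded_iff using deriv_bound[OF lip hol] by blast
  then have "(sup_norm (deriv f))-lipschitz_on unit_disc f"
    by (intro lipschitz_on_disc_if_deriv_bounded hol sup_norm_upper)
  then show "lip_const f \<le> sup_norm (deriv f)"
    by (intro lip_const_least) (auto dest: lipschitz_onD simp: dist_norm)
next
  have "(lip_const f)-lipschitz_on unit_disc f"
    by (rule lipschitz_onI) (auto simp: dist_norm intro: lip_const_upper[OF lip] lip_const_nonneg[OF lip])
  then show "sup_norm (deriv f) \<le> lip_const f"
    by (intro sup_norm_least deriv_bound[OF _ hol])
qed

lemma norm_hlip0_deriv: "norm (hlip0_deriv f) = norm f"
proof transfer
  fix f :: "complex \<Rightarrow> complex"
  assume "f holomorphic_on unit_disc \<and> (\<exists>C. C-lipschitz_on unit_disc f) \<and>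
      f 0 = 0 \<and> (\<forall>z. z \<notin> unit_disc \<longrightarrow> f z = 0)"
  then have "lip_const f = sup_norm (deriv f)"
    using lip_const_eq_sup_norm_deriv by blast
  then show "sup_norm (\<lambda>z. if z \<in> unit_disc then deriv f z else 0) = lip_const f"
    by (simp add: sup_norm_def del: mem_ball mem_ball_0 cong: SUP_cong)
qed

lemma linear_hlip0_deriv: "linear hlip0_deriv"
proof (rule linearI)
  show "hlip0_deriv (f + g) = hlip0_deriv f + hlip0_deriv g" for f g
    by transfer (auto simp: fun_eq_iff holomorphic_on_imp_differentiable_at)
  show "hlip0_deriv (r *\<^sub>R f) = r *\<^sub>R hlip0_deriv f" for r f
    by transfer (auto simp: fun_eq_iff scaleR_conv_of_real holomorphic_on_imp_differentiable_at)
qed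

lemma inj_hlip0_deriv: "inj hlip0_deriv"
proof -
  have "f = 0" if "hlip0_deriv f = 0" for f
    using that norm_hlip0_deriv[of f] by simp
  then show ?thesis
    by (simp add: linear_injective_0[OF linear_hlip0_deriv])
qed

text \<open>
  The preimage of \<open>h\<close> is its primitive normalised to vanish at \<open>0\<close>.  Being an element of the space
  means being Lipschitz, and this is where boundedness of \<open>h\<close> enters.
\<close>

lemma surj_hlip0_deriv: "surj hlip0_deriv"
proof -
  have "\<exists>f. hlip0_deriv f = h" for h
  proof transfer
    fix h :: "complex \<Rightarrow> complex"
    assume h: "h holomorphic_on unit_disc \<and> bounded (h ` unit_disc) \<and>
      (\<forall>z. z \<notin> unit_disc \<longrightarrow> h z = 0)"
    then obtain g where g: "\<And>z. z \<in> unit_disc \<Longrightarrow> (g has_field_derivative h z) (at z within unit_disc)"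
      using holomorphic_convex_primitive'[of unit_disc h] by auto
    define f where "f z = (if z \<in> unit_disc then g z - g 0 else 0)" for z
    have f: "(f has_field_derivative h z) (at z)" if "z \<in> unit_disc" for z
    proof (rule has_field_derivative_transform_within_open[of "\<lambda>z. g z - g 0" _ _ unit_disc])
      show "((\<lambda>z. g z - g 0) has_field_derivative h z) (at z)"
        using g[OF that] that by (auto intro!: derivative_eq_intros simp: at_within_open[of _ unit_disc])
    qed (use that in \<open>auto simp: f_def\<close>)
    then have deriv_f: "deriv f z = h z" if "z \<in> unit_disc" for z
      using that DERIV_imp_deriv by blast
    have hol: "f holomorphic_on unit_disc"
      using f by (meson holomorphic_on_open open_ball)
    obtain B where "\<And>z. z \<in> unit_disc \<Longrightarrow> norm (h z) \<le> B"
      using h unfolding bounded_iff by blast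
    then have "B-lipschitz_on unit_disc f"
      by (intro lipschitz_on_disc_if_deriv_bounded hol) (simp add: deriv_f)
    moreover have "(\<lambda>z. if z \<in> unit_disc then deriv f z else 0) = h"
      using h deriv_f by auto
    ultimately show "\<exists>f\<in>{f. f holomorphic_on unit_disc \<and> (\<exists>C. C-lipschitz_on unit_disc f) \<and>
        f 0 = 0 \<and> (\<forall>z. z \<notin> unit_disc \<longrightarrow> f z = 0)}.
        (\<lambda>z. if z \<in> unit_disc then deriv f z else 0) = h"
      using hol by (intro bexI[of _ f]) (auto simp: f_def)
  qed
  then show ?thesis
    by (metis surjI)
qed

lemma norm_preserving_image_cball:
  fixes T :: "'a::real_normed_vector \<Rightarrow> 'b::real_normed_vector"
  assumes "surj T" "\<And>x. norm (T x) = norm x"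
  shows "T ` cball 0 r = cball 0 r"
proof
  show "cball 0 r \<subseteq> T ` cball 0 r"
  proof
    fix y :: 'b assume "y \<in> cball 0 r"
    moreover obtain x where "y = T x"
      using assms(1) by auto
    ultimately show "y \<in> T ` cball 0 r"
      using assms(2) by simp
  qed
qed (use assms(2) in auto)

text \<open>An extreme point of a set is a point whose singleton is a face, and faces are preserved.\<close>

lemma extreme_point_of_linear_image:
  assumes "linear T" "inj T"
  shows "T x extreme_point_of T ` S \<longleftrightarrow> x extreme_point_of S"
  using face_of_linear_image[OF assms, of "{x}" S] by (simp add: face_of_singleton)

theorem corollary2p10:
  fixes f :: hlip0
  shows "f extreme_point_of (cball 0 1 :: hlip0 set) \<longleftrightarrow>
         hlip0_deriv f extreme_point_of (cball 0 1 :: hinf set)"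
  using extreme_point_of_linear_image[OF linear_hlip0_deriv inj_hlip0_deriv, of f "cball 0 1"]
  unfolding norm_preserving_image_cball[OF surj_hlip0_deriv norm_hlip0_deriv]
  by (rule sym)

end
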